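(* Let $n\ge5$ be an odd integer and let $$L=\begin{bmatrix}\frac{n-1}{2} & -\frac12\mathbf{e}' & \mathbf{0}'\\ -\frac12\mathbf{e} & A & B\\ \mathbf{0} & B & I_{n-1}\end{bmatrix},$$ where $A=\mathrm{Circ}(\mathbf{x}')$ and $B=\mathrm{Circ}(\mathbf{y}')$ are the circulant matrices of order $n-1$ defined in the context. Then the rank of $L$ is $2n-3$.
   Context: A prime denotes transpose; $\mathbf{e},\mathbf{0}\in\mathbb{R}^{n-1}$ are the all-ones and zero column vectors; $I_{n-1}$ is the identity matrix of order $n-1$. For $\mathbf{a}=(a_1,\dots,a_N)'\in\mathbb{R}^N$, $\mathrm{Circ}(\mathbf{a}')$ is the $N\times N$ circulant matrix with first row $(a_1,a_2,\dots,a_N)$, each subsequent row being the previous row cyclically shifted one place to the right. Vectors $\mathbf{x},\mathbf{y}$ (for odd $n\ge5$): put $m=\frac{n-1}{2}$ and, for $1\le k\le m$, $\alpha_k=(-1)^{k+1}\left[2m^2-6(m-k)^2+7\right]$. Then $$\mathbf{x}=\frac{1}{6(n-1)}(n^2+4n-12,\alpha_1,\alpha_2,\dots,\alpha_{m-1},\alpha_m,\alpha_{m-1},\dots,\alpha_2,\alpha_1)'\in\mathbb{R}^{n-1},$$ $$\mathbf{y}=\frac{1}{n-1}(2-n,-1,1,-1,1,\dots,-1,1,-1)'\in\mathbb{R}^{n-1}.$$ *)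

theory Defs
  imports Complex_Main "Jordan_Normal_Form.DL_Rank"
begin

text \<open>Indices are 0-based: row \<open>i\<close> is the first row shifted \<open>i\<close> places to the right, so its
  entry \<open>j\<close> is the entry \<open>j - i\<close> (modulo \<open>N\<close>) of the first row.\<close>

definition circulant_mat :: "'a vec \<Rightarrow> 'a mat" where
  "circulant_mat a = (let N = dim_vec a in mat N N (\<lambda>(i, j). a $ ((j + N - i) mod N)))"

definition alpha :: "nat \<Rightarrow> nat \<Rightarrow> real" where
  "alpha m k = (-1) ^ (k + 1) * (2 * (real m)\<^sup>2 - 6 * (real m - real k)\<^sup>2 + 7)"

definition x_vec :: "nat \<Rightarrow> real vec" where
  "x_vec n = (let m = (n - 1) div 2 in
     (1 / (6 * (real n - 1))) \<cdot>\<^sub>v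
       vec_of_list (((real n)\<^sup>2 + 4 * real n - 12) #
         map (alpha m) [1..<m] @ [alpha m m] @ map (alpha m) (rev [1..<m])))"

definition y_vec :: "nat \<Rightarrow> real vec" where
  "y_vec n = (1 / (real n - 1)) \<cdot>\<^sub>v
     vec (n - 1) (\<lambda>j. if j = 0 then 2 - real n else (-1) ^ j)"

text \<open>The border \<open>(-1/2 e', 0')\<close> of the first row is also, transposed, that of the first
  column; the remaining \<open>2 (n - 1)\<close> rows and columns form the blocks \<open>A, B, B, I\<close>.\<close>

definition L_mat :: "nat \<Rightarrow> real mat" where
  "L_mat n = (let N = n - 1;
      A = circulant_mat (x_vec n);
      B = circulant_mat (y_vec n);
      b = vec N (\<lambda>_. - (1 / 2)) @\<^sub>v 0\<^sub>v N
    in four_block_mat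
         (mat 1 1 (\<lambda>_. (real n - 1) / 2)) (mat_of_row b)
         (mat_of_cols (2 * N) [b]) (four_block_mat A B B (1\<^sub>m N)))"

lemma dim_circulant_mat [simp]:
  "dim_row (circulant_mat a) = dim_vec a" "dim_col (circulant_mat a) = dim_vec a"
  by (simp_all add: circulant_mat_def Let_def)

lemma dim_x_vec: "odd n \<Longrightarrow> n \<ge> 3 \<Longrightarrow> dim_vec (x_vec n) = n - 1"
  by (erule oddE) (simp add: x_vec_def)

lemma dim_y_vec: "dim_vec (y_vec n) = n - 1"
  by (simp add: y_vec_def)

lemma L_mat_carrier:
  assumes "odd n" "n \<ge> 3"
  shows "L_mat n \<in> carrier_mat (2 * n - 1) (2 * n - 1)"
proof -
  have "1 + (n - 1 + (n - 1)) = 2 * n - 1"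
    using assms(2) by linarith
  then show ?thesis
    using dim_x_vec[OF assms] by (intro carrier_matI) (simp_all add: L_mat_def Let_def)
qed

end

theory Submission
  imports Defs "Jordan_Normal_Form.Matrix_Kernel"
begin

text \<open>By rank-nullity it suffices that \<open>L\<close> has a two-dimensional kernel. Put \<open>N = n - 1 = 2 m\<close>, let
  \<open>J\<close> be the all-ones matrix, and let \<open>P\<close> be the orthogonal projection onto the alternating vector
  \<open>w = (1, -1, 1, \<dots>)\<close>. Then \<open>B = P - I\<close>, so eliminating the border and the last block reduces the
  kernel of \<open>L\<close> to that of \<open>S = A - B\<^sup>2 - J / (2 N) = A - I + P - J / (2 N)\<close>. The first row of
  \<open>S\<close> is \<open>(-1)\<^sup>k\<close> times a quadratic in \<open>k\<close>, plus a constant; hence, with \<open>T\<close> the cyclic shift, the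
  operator \<open>T + 2 I + T\<^sup>-\<^sup>1\<close> turns \<open>S\<close> into \<open>2 I - 2 P - (2 / N) J\<close>. So the kernel of \<open>S\<close> is contained
  in the span of \<open>e\<close> and \<open>w\<close>, and a direct summation shows that both vectors belong to it.\<close>

section \<open>Rank and kernel dimension of a matrix\<close>

text \<open>Rank-nullity for the map sending \<open>v\<close> to \<open>A *\<^sub>v v\<close>: its
  image is the column space and its kernel is \<open>mat_kernel A\<close>.\<close>

lemma rank_plus_kernel_dim:
  fixes A :: "'a :: field mat"
  assumes A: "A \<in> carrier_mat nr nc"
  shows "vec_space.rank nr A + kernel.dim nc A = nc"
proof -
  interpret W: vec_space "TYPE('a)" nr .
  interpret K: kernel nr nc A by unfold_locales (rule A)
  interpret T: linear_map class_ring "module_vec TYPE('a) nc" "module_vec TYPE('a) nr" "\<lambda>v. A *\<^sub>v v"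
  proof unfold_locales
    show "(*\<^sub>v) A \<in> LinearCombinations.module_hom class_ring (module_vec TYPE('a) nc) (module_vec TYPE('a) nr)"
      using A by (auto simp: LinearCombinations.module_hom_def module_vec_simps class_ring_simps
        mult_add_distrib_mat_vec mult_mat_vec)
  qed
  have "T.im = W.span (set (cols A))"
    using W.col_space_eq[OF A] A by (auto simp: W.col_space_def T.im_def module_vec_simps)
  moreover have "T.ker = mat_kernel A"
    using A by (auto simp: T.ker_def mat_kernel_def module_vec_simps)
  ultimately show ?thesis
    using T.rank_nullity[OF K.NC.fin_dim] K.NC.dim_is_n
    by (simp add: W.rank_def)
qed

lemma kernel_dim_two:
  fixes A :: "'a :: field mat"
  assumes A: "A \<in> carrier_mat nr nc" and v: "v \<in> carrier_vec nc" and w: "w \<in> carrier_vec nc"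
    and ker: "mat_kernel A = {a \<cdot>\<^sub>v v + b \<cdot>\<^sub>v w | a b. True}"
    and indep: "\<And>a b. a \<cdot>\<^sub>v v + b \<cdot>\<^sub>v w = 0\<^sub>v nc \<Longrightarrow> a = 0 \<and> b = 0"
  shows "kernel.dim nc A = 2"
proof -
  interpret K: kernel nr nc A by unfold_locales (rule A)
  \<comment> \<open>If the vectors coincided, \<open>{v, w}\<close> would collapse to one element;
    the coefficients 1 and -1 rule this out.\<close>
  have "v \<noteq> w"
  proof
    assume "v = w"
    then have "1 \<cdot>\<^sub>v v + (-1) \<cdot>\<^sub>v w = 0\<^sub>v nc" using w by (intro eq_vecI) auto
    then show False using indep by fastforce
  qed
  then have lc: "K.NC.lincomb f {v, w} = f v \<cdot>\<^sub>v v + f w \<cdot>\<^sub>v w" for f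
    using v w by (intro eq_vecI) (auto simp: K.NC.lincomb_index K.NC.lincomb_dim)
  have "v = 1 \<cdot>\<^sub>v v + 0 \<cdot>\<^sub>v w" "w = 0 \<cdot>\<^sub>v v + 1 \<cdot>\<^sub>v w"
    using v w by auto
  then have sub: "{v, w} \<subseteq> mat_kernel A"
    unfolding ker by blast
  have "K.NC.lin_indpt {v, w}"
    using indep v w lc by (intro K.NC.finite_lin_indpt2) auto
  then have "K.Ker.lin_indpt {v, w}"
    by (simp only: K.lindep_same[OF sub] not_False_eq_True)
  moreover have "K.NC.span {v, w} = mat_kernel A"
  proof
    show "K.NC.span {v, w} \<subseteq> mat_kernel A"
      using v w K.NC.finite_span[of "{v, w}"] by (auto simp: lc ker)
    show "mat_kernel A \<subseteq> K.NC.span {v, w}"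
    proof
      fix z assume "z \<in> mat_kernel A"
      then obtain a b where "z = a \<cdot>\<^sub>v v + b \<cdot>\<^sub>v w" by (auto simp: ker)
      then have "z = K.NC.lincomb (\<lambda>u. if u = v then a else b) {v, w}"
        using \<open>v \<noteq> w\<close> by (simp add: lc)
      then show "z \<in> K.NC.span {v, w}"
        using v w K.NC.finite_span[of "{v, w}"] by auto
    qed
  qed
  ultimately have "K.Ker.basis {v, w}"
    unfolding K.Ker.basis_def using sub K.span_same by simp
  then show ?thesis
    using K.Ker.dim_basis[of "{v, w}"] \<open>v \<noteq> w\<close> by simp
qed

section \<open>Cyclic indices\<close>

text \<open>This is the index at which \<open>circulant_mat\<close> reads its first row. Adding
  \<open>N\<close> before subtracting avoids truncation for \<open>i < N\<close>.\<close>

definition cyc :: "nat \<Rightarrow> nat \<Rightarrow> nat \<Rightarrow> nat" where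
  "cyc N i j = (j + N - i) mod N"

lemma mod_less_double: "a < 2 * N \<Longrightarrow> a mod N = (if a < N then a else a - N)" for a N :: nat
  by (simp add: le_mod_geq)

lemma cyc_eq: "i < N \<Longrightarrow> j < N \<Longrightarrow> cyc N i j = (if i \<le> j then j - i else j + N - i)"
  by (auto simp: cyc_def mod_less_double)

lemma bij_betw_cyc:
  assumes "i < N"
  shows "bij_betw (cyc N i) {..<N} {..<N}"
proof -
  have "inj_on (cyc N i) {..<N}"
    using assms by (auto simp: inj_on_def cyc_eq split: if_splits)
  moreover have "cyc N i ` {..<N} \<subseteq> {..<N}"
    using assms by (auto simp: cyc_def)
  ultimately show ?thesis
    by (simp add: bij_betw_def endo_inj_surj)
qed

text \<open>Parity survives reduction modulo an even \<open>N\<close>. Hence the circulant of the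
  alternating vector is a rank-one matrix, a multiple of the projection \<open>P\<close>.\<close>

lemma minus_one_power_cyc:
  assumes "even N" "i < N" "j < N"
  shows "(-1 :: 'a :: ring_1) ^ cyc N i j = (-1) ^ (i + j)"
  using assms by (auto simp: cyc_eq minus_one_power_iff)

section \<open>The Schur complement and its kernel\<close>

text \<open>The first row of the circulant Schur complement \<open>A - B\<^sup>2 - J / (2 N)\<close>, where
  \<open>N = 2 m\<close> and \<open>J\<close> is the all-ones matrix.\<close>

definition schur :: "nat \<Rightarrow> nat \<Rightarrow> real" where
  "schur m k = (-1) ^ k * (6 * (real m - real k)\<^sup>2 - 2 * (real m)\<^sup>2 - 1) / (12 * real m) - 1 / (4 * real m)"

text \<open>The alternating sign turns the weights 1, 2, 1 into minus a second difference of the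
  quadratic, which is constant; this gives the term with \<open>(-1) ^ k\<close>, and the constant
  part of \<open>schur\<close> gives the other. The quadratic is symmetric about \<open>m\<close>,
  so the wrap at \<open>k = 2 * m - 1\<close> is seamless, but at \<open>k = 0\<close> its value at
  1 replaces that at -1, and the defect is 2.\<close>

lemma schur_recurrence:
  assumes m: "m > 0" and k: "k < 2 * m"
  shows "schur m ((k + 2 * m - 1) mod (2 * m)) + 2 * schur m k + schur m ((k + 1) mod (2 * m))
    = (if k = 0 then 2 else 0) - (1 + (-1) ^ k) / real m"
proof -
  consider "k = 0" | "k > 0" "k + 1 < 2 * m" | "k + 1 = 2 * m" "k > 0" using assms by linarith
  then show ?thesis
  proof cases
    case 1
    then have "(k + 2 * m - 1) mod (2 * m) = 2 * m - 1" "(k + 1) mod (2 * m) = 1"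
      using assms by auto
    moreover have "odd (2 * m - 1)" using assms by simp
    ultimately show ?thesis
      using assms 1 by (simp add: schur_def of_nat_diff field_simps power2_eq_square)
  next
    case 2
    then obtain l where l: "k = Suc l" by (cases k) auto
    have "k + 2 * m - 1 = l + 2 * m" using l by simp
    then have "(k + 2 * m - 1) mod (2 * m) = l" "(k + 1) mod (2 * m) = k + 1"
      using 2 l by auto
    then show ?thesis
      using assms l by (cases "even l") (simp_all add: schur_def field_simps power2_eq_square)
  next
    case 3
    obtain l where "m = Suc l"
      using m by (cases m) auto
    with 3 have l: "k = Suc (2 * l)" "m = Suc l"
      by simp_all
    then have mod: "(k + 2 * m - 1) mod (2 * m) = 2 * l" "(k + 1) mod (2 * m) = 0"
      by (simp_all add: mod_less_double)
    have e: "real m - real (2 * l) = 2 - real m" "real m - real k = 1 - real m"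
        "(-1 :: real) ^ (2 * l) = 1" "(-1 :: real) ^ k = -1" "k \<noteq> 0"
      using l by simp_all
    show ?thesis
      unfolding mod schur_def e using m e(5) by (simp add: field_simps power2_eq_square)
  qed
qed

lemma sum_schur:
  assumes "m > 0"
  shows "(\<Sum>k<2 * m. schur m k) = 0"
proof -
  \<comment> \<open>Adding terms in pairs cancels the squares in the alternating part, so prefixes
    of even length have a closed form that induction can carry; it vanishes at
    \<open>p = m\<close>.\<close>
  have "(\<Sum>k<2 * p. schur m k) = (6 * (2 * m * p - 2 * p * (real p - 1) - p)) / (12 * m) - 2 * p / (4 * m)" for p
  proof (induction p)
    case (Suc p)
    have "schur m (2 * p) + schur m (Suc (2 * p)) = (6 * (2 * m - 4 * real p - 1)) / (12 * m) - 2 / (4 * m)"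
      using assms by (simp add: schur_def field_simps power2_eq_square)
    with Suc show ?case
      using assms by (simp add: field_simps)
  qed simp
  from this[of m] show ?thesis using assms by (simp add: field_simps)
qed

lemma sum_alternating_schur:
  assumes "m > 0"
  shows "(\<Sum>k<2 * m. schur m k * (-1) ^ k) = 0"
proof -
  \<comment> \<open>The signs now square away and the constant part of \<open>schur\<close> cancels
    in pairs. What remains follows the standard sums of \<open>k\<close> and its square for
    \<open>k < 2 * p\<close>.\<close>
  have "(\<Sum>k<2 * p. schur m k * (-1) ^ k) =
     (6 * m\<^sup>2 * (2 * p) - 6 * m * (2 * p) * (2 * real p - 1) + (2 * real p - 1) * (2 * p) * (4 * real p - 1)
       - (2 * m\<^sup>2 + 1) * (2 * p)) / (12 * m)" for p
  proof (induction p)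
    case (Suc p)
    have "schur m (2 * p) * (-1) ^ (2 * p) + schur m (Suc (2 * p)) * (-1) ^ Suc (2 * p)
        = (6 * (real m - 2 * p)\<^sup>2 + 6 * (real m - 2 * p - 1)\<^sup>2 - 4 * m\<^sup>2 - 2) / (12 * m)"
      using assms by (simp add: schur_def field_simps power2_eq_square)
    with Suc show ?case
      using assms by (simp add: field_simps power2_eq_square)
  qed simp
  from this[of m] show ?thesis using assms by (simp add: field_simps power2_eq_square)
qed

text \<open>Adding the equations of rows \<open>i - 1\<close>, \<open>i\<close>,
  \<open>i + 1\<close> (cyclically) with weights 1, 2, 1 leaves, by \<open>schur_recurrence\<close>,
  only \<open>u i\<close>, the sum and the alternating sum.\<close>

lemma schur_kernel:
  fixes u :: "nat \<Rightarrow> real"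
  assumes m: "m > 0" and "\<And>i. i < 2 * m \<Longrightarrow> (\<Sum>j<2 * m. schur m (cyc (2 * m) i j) * u j) = 0"
    and i: "i < 2 * m"
  shows "u i = (\<Sum>j<2 * m. u j) / (2 * m) + (-1) ^ i * ((\<Sum>j<2 * m. (-1) ^ j * u j) / (2 * m))"
proof -
  define N where "N = 2 * m"
  have N: "N > 0" "i < N" using m i by (simp_all add: N_def)
  define i1 i2 where "i1 = (i + 1) mod N" and "i2 = (i + N - 1) mod N"
  have *: "schur m (cyc N i1 j) + 2 * schur m (cyc N i j) + schur m (cyc N i2 j)
      = (if j = i then 2 else 0) - (1 + (-1) ^ (i + j)) / real m" if j: "j < N" for j
  proof -
    \<comment> \<open>Going down one row goes back one place in the first row, so \<open>i1\<close>
      supplies the predecessor and \<open>i2\<close> the successor in the recurrence.\<close>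
    have "cyc N i1 j = (cyc N i j + N - 1) mod N"
      using N j by (cases "i + 1 = N") (auto simp: i1_def cyc_eq mod_less_double)
    moreover have "cyc N i2 j = (cyc N i j + 1) mod N"
      using N j by (cases i) (auto simp: i2_def cyc_eq mod_less_double)
    moreover have "cyc N i j < N" "cyc N i j = 0 \<longleftrightarrow> j = i"
      using N j by (auto simp: cyc_eq)
    moreover have "(-1 :: real) ^ cyc N i j = (-1) ^ (i + j)"
      using N j by (intro minus_one_power_cyc) (simp_all add: N_def)
    ultimately show ?thesis using schur_recurrence[of m "cyc N i j"] m by (simp add: N_def)
  qed
  have "i1 < N" "i2 < N" using N by (simp_all add: i1_def i2_def)
  then have "0 = (\<Sum>j<N. schur m (cyc N i1 j) * u j) + 2 * (\<Sum>j<N. schur m (cyc N i j) * u j)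
      + (\<Sum>j<N. schur m (cyc N i2 j) * u j)"
    using assms(2) N by (simp add: N_def)
  also have "\<dots> = (\<Sum>j<N. (schur m (cyc N i1 j) + 2 * schur m (cyc N i j) + schur m (cyc N i2 j)) * u j)"
    by (simp add: sum.distrib sum_distrib_left algebra_simps)
  also have "\<dots> = (\<Sum>j<N. (if j = i then 2 * u j else 0) - u j / m - (-1) ^ i * ((-1) ^ j * u j / m))"
  proof (intro sum.cong refl)
    fix j assume "j \<in> {..<N}"
    then have j: "j < N" by simp
    show "(schur m (cyc N i1 j) + 2 * schur m (cyc N i j) + schur m (cyc N i2 j)) * u j
        = (if j = i then 2 * u j else 0) - u j / m - (-1) ^ i * ((-1) ^ j * u j / m)"
      unfolding *[OF j] by (simp add: power_add algebra_simps add_divide_distrib)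
  qed
  also have "\<dots> = 2 * u i - (\<Sum>j<N. u j) / m - (-1) ^ i * ((\<Sum>j<N. (-1) ^ j * u j) / m)"
    using N by (simp add: sum_subtractf sum_distrib_left sum_divide_distrib)
  finally show ?thesis by (simp add: N_def)
qed

section \<open>The circulant blocks and their action on vectors\<close>

text \<open>First-row form of \<open>A = I + S + J / (2 N) - P\<close> with
  \<open>N = 2 m\<close>.\<close>

lemma x_vec_index:
  assumes "m \<ge> 2" and k: "k < 2 * m"
  shows "x_vec (2 * m + 1) $ k
    = (if k = 0 then 1 else 0) + schur m k + 1 / (4 * m) - (-1) ^ k / (2 * m)"
proof -
  define c where "c = ((real (2 * m + 1))\<^sup>2 + 4 * real (2 * m + 1) - 12)"
  define l where "l = c # map (alpha m) [1..<m] @ [alpha m m] @ map (alpha m) (rev [1..<m])"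
  have len: "length l = 2 * m" using assms by (simp add: l_def)
  have x: "x_vec (2 * m + 1) $ k = l ! k / (12 * m)"
  proof -
    have "x_vec (2 * m + 1) = (1 / (12 * m)) \<cdot>\<^sub>v vec_of_list l"
      by (simp add: x_vec_def l_def c_def Let_def)
    then show ?thesis using k len by (simp add: vec_of_list_index)
  qed
  consider "k = 0" | "0 < k" "k < m" | "k = m" | "m < k" by linarith
  then show ?thesis
  proof cases
    case 1
    then show ?thesis using assms
      unfolding x by (simp add: l_def c_def schur_def field_simps power2_eq_square)
  next
    case 2
    then have h: "l ! k = alpha m k" by (cases k) (auto simp: l_def nth_append)
    show ?thesis using 2 assms
      unfolding x h by (simp add: alpha_def schur_def field_simps power2_eq_square)
  next
    case 3
    then have h: "l ! k = alpha m k" using assms by (cases k) (simp_all add: l_def nth_append)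
    show ?thesis using 3 assms
      unfolding x h by (simp add: alpha_def schur_def field_simps power2_eq_square)
  next
    case 4
    \<comment> \<open>The tail of the list runs backwards, so the entry sits at the mirror image of
      \<open>k\<close> about \<open>m\<close>. The reflection changes neither the parity nor the
      square.\<close>
    then have h: "l ! k = alpha m (2 * m - k)"
      using assms by (cases k) (auto simp: l_def nth_append nth_Cons' rev_nth intro!: arg_cong[of _ _ "alpha m"])
    have p: "(-1 :: real) ^ (2 * m - k + 1) = - ((-1) ^ k)"
      and r: "real m - real (2 * m - k) = - (real m - real k)"
      using k by (auto simp: minus_one_power_iff)
    show ?thesis using assms 4
      unfolding x h alpha_def p r by (simp add: schur_def field_simps power2_eq_square)
  qed
qed

lemma y_vec_index:
  assumes "m > 0" "k < 2 * m"
  shows "y_vec (2 * m + 1) $ k = (-1) ^ k / (2 * m) - (if k = 0 then 1 else 0)"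
  using assms by (simp add: y_vec_def field_simps)

lemma circulant_mult_vec_index:
  fixes a u :: "'a :: semiring_0 vec"
  assumes "dim_vec a = N" "dim_vec u = N" "i < N"
  shows "(circulant_mat a *\<^sub>v u) $ i = (\<Sum>j<N. a $ cyc N i j * u $ j)"
  using assms by (simp add: circulant_mat_def Let_def scalar_prod_def cyc_def lessThan_atLeast0)

lemma circulant_x_mult_index:
  assumes m: "m \<ge> 2" and u: "u \<in> carrier_vec (2 * m)" and i: "i < 2 * m"
  shows "(circulant_mat (x_vec (2 * m + 1)) *\<^sub>v u) $ i
    = u $ i + (\<Sum>j<2 * m. schur m (cyc (2 * m) i j) * u $ j) + (\<Sum>j<2 * m. u $ j) / (4 * m)
      - (-1) ^ i * ((\<Sum>j<2 * m. (-1) ^ j * u $ j) / (2 * m))"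
proof -
  define N where "N = 2 * m"
  have "(circulant_mat (x_vec (2 * m + 1)) *\<^sub>v u) $ i = (\<Sum>j<N. x_vec (2 * m + 1) $ cyc N i j * u $ j)"
    using m u i by (intro circulant_mult_vec_index) (simp_all add: dim_x_vec N_def)
  also have "\<dots> = (\<Sum>j<N. (if j = i then u $ j else 0) + schur m (cyc N i j) * u $ j
      + u $ j / (4 * m) - (-1) ^ i * ((-1) ^ j * u $ j / (2 * m)))"
  proof (intro sum.cong refl)
    fix j assume "j \<in> {..<N}"
    then have j: "j < N" by simp
    have c: "cyc N i j < 2 * m" "cyc N i j = 0 \<longleftrightarrow> j = i"
      and p: "(-1 :: real) ^ cyc N i j = (-1) ^ (i + j)"
      using i j minus_one_power_cyc[of N i j] by (auto simp: cyc_eq N_def)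
    show "x_vec (2 * m + 1) $ cyc N i j * u $ j = (if j = i then u $ j else 0)
        + schur m (cyc N i j) * u $ j + u $ j / (4 * m) - (-1) ^ i * ((-1) ^ j * u $ j / (2 * m))"
      unfolding x_vec_index[OF m c(1)] c(2) p
      by (simp add: power_add algebra_simps)
  qed
  also have "\<dots> = u $ i + (\<Sum>j<N. schur m (cyc N i j) * u $ j) + (\<Sum>j<N. u $ j) / (4 * m)
      - (-1) ^ i * ((\<Sum>j<N. (-1) ^ j * u $ j) / (2 * m))"
    using i by (simp add: N_def sum.distrib sum_subtractf sum_distrib_left sum_divide_distrib)
  finally show ?thesis by (simp add: N_def)
qed

lemma circulant_y_mult_index:
  assumes m: "m > 0" and u: "u \<in> carrier_vec (2 * m)" and i: "i < 2 * m"
  shows "(circulant_mat (y_vec (2 * m + 1)) *\<^sub>v u) $ i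
    = (-1) ^ i * ((\<Sum>j<2 * m. (-1) ^ j * u $ j) / (2 * m)) - u $ i"
proof -
  define N where "N = 2 * m"
  have "(circulant_mat (y_vec (2 * m + 1)) *\<^sub>v u) $ i = (\<Sum>j<N. y_vec (2 * m + 1) $ cyc N i j * u $ j)"
    using m u i by (intro circulant_mult_vec_index) (simp_all add: dim_y_vec N_def)
  also have "\<dots> = (\<Sum>j<N. (-1) ^ i * ((-1) ^ j * u $ j / (2 * m)) - (if j = i then u $ j else 0))"
  proof (intro sum.cong refl)
    fix j assume "j \<in> {..<N}"
    then have j: "j < N" by simp
    have c: "cyc N i j < 2 * m" "cyc N i j = 0 \<longleftrightarrow> j = i"
      and p: "(-1 :: real) ^ cyc N i j = (-1) ^ (i + j)"
      using i j minus_one_power_cyc[of N i j] by (auto simp: cyc_eq N_def)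
    show "y_vec (2 * m + 1) $ cyc N i j * u $ j
        = (-1) ^ i * ((-1) ^ j * u $ j / (2 * m)) - (if j = i then u $ j else 0)"
      unfolding y_vec_index[OF m c(1)] c(2) p
      by (simp add: power_add algebra_simps)
  qed
  also have "\<dots> = (-1) ^ i * ((\<Sum>j<N. (-1) ^ j * u $ j) / (2 * m)) - u $ i"
    using i by (simp add: N_def sum_subtractf sum_distrib_left sum_divide_distrib)
  finally show ?thesis by (simp add: N_def)
qed

section \<open>The kernel of L\<close>

text \<open>The three block rows give one equation each; the border row is doubled, and the
  contribution of the border column is moved to the right as \<open>t / 2\<close>.\<close>

lemma L_mat_mult_eq_0_iff:
  fixes u v :: "real vec"
  assumes m: "m > 0" and u: "u \<in> carrier_vec (2 * m)" and v: "v \<in> carrier_vec (2 * m)"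
  defines "A \<equiv> circulant_mat (x_vec (2 * m + 1))" and "B \<equiv> circulant_mat (y_vec (2 * m + 1))"
  shows "L_mat (2 * m + 1) *\<^sub>v (vec 1 (\<lambda>_. t) @\<^sub>v (u @\<^sub>v v)) = 0\<^sub>v (4 * m + 1) \<longleftrightarrow>
    (\<Sum>j<2 * m. u $ j) = 2 * m * t \<and>
    (\<forall>i<2 * m. (A *\<^sub>v u) $ i + (B *\<^sub>v v) $ i = t / 2 \<and> (B *\<^sub>v u) $ i + v $ i = 0)"
proof -
  define N where "N = 2 * m"
  define b where "b = vec N (\<lambda>_. - (1 / 2) :: real) @\<^sub>v 0\<^sub>v N"
  have A: "A \<in> carrier_mat N N" and B: "B \<in> carrier_mat N N"
    using m by (auto simp: A_def B_def N_def dim_x_vec dim_y_vec intro!: carrier_matI)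
  have u: "u \<in> carrier_vec N" and v: "v \<in> carrier_vec N"
    using u v by (simp_all add: N_def)
  have b: "b \<in> carrier_vec (N + N)" by (simp add: b_def)
  have M: "four_block_mat A B B (1\<^sub>m N) *\<^sub>v (u @\<^sub>v v) = (A *\<^sub>v u + B *\<^sub>v v) @\<^sub>v (B *\<^sub>v u + v)"
    using four_block_mat_mult_vec[OF A B B one_carrier_mat u v] v by simp
  have "L_mat (2 * m + 1) = four_block_mat (mat 1 1 (\<lambda>_. real m)) (mat_of_row b)
      (mat_of_cols (N + N) [b]) (four_block_mat A B B (1\<^sub>m N))"
  proof -
    have n: "2 * m + 1 - 1 = N" "2 * N = N + N" "(real (2 * m + 1) - 1) / 2 = real m"
      by (simp_all add: N_def)
    show ?thesis
      unfolding L_mat_def Let_def n A_def B_def b_def by (rule refl)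
  qed
  also have "\<dots> *\<^sub>v (vec 1 (\<lambda>_. t) @\<^sub>v (u @\<^sub>v v)) =
      (mat 1 1 (\<lambda>_. real m) *\<^sub>v vec 1 (\<lambda>_. t) + mat_of_row b *\<^sub>v (u @\<^sub>v v)) @\<^sub>v
      (mat_of_cols (N + N) [b] *\<^sub>v vec 1 (\<lambda>_. t) + ((A *\<^sub>v u + B *\<^sub>v v) @\<^sub>v (B *\<^sub>v u + v)))"
    unfolding M[symmetric] using A B u v b by (intro four_block_mat_mult_vec) auto
  also have "mat 1 1 (\<lambda>_. real m) *\<^sub>v vec 1 (\<lambda>_. t) + mat_of_row b *\<^sub>v (u @\<^sub>v v)
      = vec 1 (\<lambda>_. m * t - (\<Sum>j<N. u $ j) / 2)"
  proof -
    have "b \<bullet> (u @\<^sub>v v) = vec N (\<lambda>_. - (1 / 2)) \<bullet> u + 0\<^sub>v N \<bullet> v"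
      unfolding b_def using u v by (intro scalar_prod_append) auto
    also have "\<dots> = - (\<Sum>j<N. u $ j) / 2"
      using u v by (simp add: scalar_prod_def lessThan_atLeast0 sum_divide_distrib sum_negf)
    finally show ?thesis
      by (intro eq_vecI) (auto simp: scalar_prod_def[of "vec _ _"])
  qed
  also have "mat_of_cols (N + N) [b] *\<^sub>v vec 1 (\<lambda>_. t) + ((A *\<^sub>v u + B *\<^sub>v v) @\<^sub>v (B *\<^sub>v u + v))
      = vec N (\<lambda>i. (A *\<^sub>v u) $ i + (B *\<^sub>v v) $ i - t / 2) @\<^sub>v vec N (\<lambda>i. (B *\<^sub>v u) $ i + v $ i)"
    using A B u v b
    by (intro eq_vecI) (auto simp: mat_of_cols_def scalar_prod_def b_def)
  finally have L: "L_mat (2 * m + 1) *\<^sub>v (vec 1 (\<lambda>_. t) @\<^sub>v (u @\<^sub>v v))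
      = vec 1 (\<lambda>_. m * t - (\<Sum>j<N. u $ j) / 2) @\<^sub>v
        (vec N (\<lambda>i. (A *\<^sub>v u) $ i + (B *\<^sub>v v) $ i - t / 2) @\<^sub>v vec N (\<lambda>i. (B *\<^sub>v u) $ i + v $ i))" .
  have zero: "0\<^sub>v (4 * m + 1) = 0\<^sub>v 1 @\<^sub>v (0\<^sub>v N @\<^sub>v (0\<^sub>v N :: real vec))"
    by (intro eq_vecI) (auto simp: N_def)
  have 1: "vec 1 (\<lambda>_. m * t - (\<Sum>j<N. u $ j) / 2) = 0\<^sub>v 1 \<longleftrightarrow> (\<Sum>j<N. u $ j) = 2 * m * t"
    by (auto simp: vec_eq_iff)
  have 2: "vec N f = 0\<^sub>v N \<longleftrightarrow> (\<forall>i<N. f i = 0)" for f :: "nat \<Rightarrow> real"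
    by (auto simp: vec_eq_iff)
  show ?thesis
    unfolding L zero append_vec_eq[OF vec_carrier zero_carrier_vec] 1 2
    by (auto simp: N_def)
qed


lemma sum_alternating: "(\<Sum>j<2 * m. (-1) ^ j) = (0 :: 'a :: ring_1)"
  by (induction m) simp_all

text \<open>\<open>S\<close> kills both the constant and the alternating vector: writing
  \<open>(-1) ^ j\<close> through \<open>cyc\<close> and permuting the columns reduces every row to
  the two first-row sums.\<close>

lemma sum_schur_cyc:
  assumes "m > 0" and i: "i < 2 * m"
  shows "(\<Sum>j<2 * m. schur m (cyc (2 * m) i j) * (a + b * (-1) ^ j)) = 0"
proof -
  have "(\<Sum>j<2 * m. schur m (cyc (2 * m) i j) * (a + b * (-1) ^ j))
      = (\<Sum>j<2 * m. schur m (cyc (2 * m) i j) * (a + b * (-1) ^ i * (-1) ^ cyc (2 * m) i j))"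
    using i by (intro sum.cong refl) (simp add: minus_one_power_cyc power_add)
  also have "\<dots> = (\<Sum>k<2 * m. schur m k * (a + b * (-1) ^ i * (-1) ^ k))"
    using bij_betw_cyc[OF i] by (rule sum.reindex_bij_betw)
  also have "\<dots> = a * (\<Sum>k<2 * m. schur m k) + b * (-1) ^ i * (\<Sum>k<2 * m. schur m k * (-1) ^ k)"
    by (simp add: sum_distrib_left sum.distrib algebra_simps)
  finally show ?thesis using assms by (simp add: sum_schur sum_alternating_schur)
qed

lemma L_mat_kernel_iff:
  fixes u v :: "real vec"
  assumes m: "m \<ge> 2" and u: "u \<in> carrier_vec (2 * m)" and v: "v \<in> carrier_vec (2 * m)"
  shows "L_mat (2 * m + 1) *\<^sub>v (vec 1 (\<lambda>_. t) @\<^sub>v (u @\<^sub>v v)) = 0\<^sub>v (4 * m + 1) \<longleftrightarrow>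
    (\<exists>b. \<forall>i<2 * m. u $ i = t + b * (-1) ^ i \<and> v $ i = t)"
    (is "?L = 0\<^sub>v _ \<longleftrightarrow> ?R")
proof -
  define \<sigma> \<tau> where "\<sigma> = (\<Sum>j<2 * m. (-1) ^ j * u $ j)" and "\<tau> = (\<Sum>j<2 * m. (-1) ^ j * v $ j)"
  define S where "S i = (\<Sum>j<2 * m. schur m (cyc (2 * m) i j) * u $ j)" for i
  have "m > 0" using m by simp
  have eqs: "?L = 0\<^sub>v (4 * m + 1) \<longleftrightarrow> (\<Sum>j<2 * m. u $ j) = 2 * m * t \<and>
    (\<forall>i<2 * m. u $ i + S i + (\<Sum>j<2 * m. u $ j) / (4 * m) - (-1) ^ i * (\<sigma> / (2 * m))
      + ((-1) ^ i * (\<tau> / (2 * m)) - v $ i) = t / 2 \<and>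
      (-1) ^ i * (\<sigma> / (2 * m)) - u $ i + v $ i = 0)"
    unfolding L_mat_mult_eq_0_iff[OF \<open>m > 0\<close> u v] S_def \<sigma>_def \<tau>_def
    using circulant_x_mult_index[OF m u] circulant_y_mult_index[OF \<open>m > 0\<close> u]
      circulant_y_mult_index[OF \<open>m > 0\<close> v] by simp
  show ?thesis
  proof
    assume "?L = 0\<^sub>v (4 * m + 1)"
    then have sum: "(\<Sum>j<2 * m. u $ j) = 2 * m * t"
      and *: "\<And>i. i < 2 * m \<Longrightarrow> u $ i + S i + (\<Sum>j<2 * m. u $ j) / (4 * m) - (-1) ^ i * (\<sigma> / (2 * m))
        + ((-1) ^ i * (\<tau> / (2 * m)) - v $ i) = t / 2 \<and>
        (-1) ^ i * (\<sigma> / (2 * m)) - u $ i + v $ i = 0"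
      unfolding eqs by blast+
    have 2: "v $ i = u $ i - (-1) ^ i * (\<sigma> / (2 * m))" if "i < 2 * m" for i
      using conjunct2[OF *[OF that]] by linarith
    \<comment> \<open>The last block row says \<open>v = u - P u\<close>, which is orthogonal to the
      alternating vector, so \<open>B\<close> contributes no projection term for
      \<open>v\<close>.\<close>
    have "\<tau> = (\<Sum>j<2 * m. (-1) ^ j * u $ j - \<sigma> / (2 * m))"
      unfolding \<tau>_def by (intro sum.cong refl) (simp add: 2 algebra_simps)
    then have "\<tau> = 0"
      using m by (simp add: sum_subtractf \<sigma>_def[symmetric])
    \<comment> \<open>The border equation makes the \<open>J / (2 N)\<close> term equal to the
      right-hand side \<open>t / 2\<close>; after eliminating \<open>v\<close> only
      \<open>S u = 0\<close> is left.\<close>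
    have "(\<Sum>j<2 * m. u $ j) / (4 * m) = t / 2"
      using sum m by simp
    then have "S i = 0" if "i < 2 * m" for i
      using *[OF that] \<open>\<tau> = 0\<close> by simp
    then have "u $ i = t + (-1) ^ i * (\<sigma> / (2 * m))" if "i < 2 * m" for i
      using schur_kernel[of m "($) u" i] that m sum by (simp add: S_def \<sigma>_def)
    then show ?R
      using 2 by (intro exI[of _ "\<sigma> / (2 * m)"]) simp
  next
    assume ?R
    then obtain b where b: "u $ i = t + b * (-1) ^ i" "v $ i = t" if "i < 2 * m" for i
      by blast
    have "(\<Sum>j<2 * m. u $ j) = 2 * m * t"
      by (simp add: b sum.distrib sum_distrib_left[symmetric] sum_alternating)
    moreover have "\<sigma> = (\<Sum>j<2 * m. t * (-1) ^ j + b)"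
      unfolding \<sigma>_def by (intro sum.cong refl) (simp add: b algebra_simps)
    then have "\<sigma> = 2 * m * b"
      by (simp add: sum.distrib sum_distrib_left[symmetric] sum_alternating)
    moreover have "\<tau> = 0"
      by (simp add: \<tau>_def b sum_distrib_right[symmetric] sum_alternating)
    moreover have "S i = 0" if "i < 2 * m" for i
      using sum_schur_cyc[OF \<open>m > 0\<close> that, of t b] by (simp add: S_def b)
    ultimately show "?L = 0\<^sub>v (4 * m + 1)"
      unfolding eqs using m by (auto simp: b field_simps)
  qed
qed

lemma L_mat_kernel_dim:
  assumes m: "m \<ge> 2"
  shows "kernel.dim (4 * m + 1) (L_mat (2 * m + 1)) = 2"
proof (rule kernel_dim_two)
  define N where "N = 2 * m"
  let ?L = "L_mat (2 * m + 1)"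
  \<comment> \<open>These are the solutions of \<open>L_mat_kernel_iff\<close> with
    \<open>t = 1\<close>, \<open>b = 0\<close> and with \<open>t = 0\<close>,
    \<open>b = 1\<close>.\<close>
  define e w :: "real vec" where "e = vec 1 (\<lambda>_. 1) @\<^sub>v (vec N (\<lambda>_. 1) @\<^sub>v vec N (\<lambda>_. 1))"
    and "w = vec 1 (\<lambda>_. 0) @\<^sub>v (vec N (\<lambda>i. (-1) ^ i) @\<^sub>v vec N (\<lambda>_. 0))"
  show L: "?L \<in> carrier_mat (4 * m + 1) (4 * m + 1)"
    using L_mat_carrier[of "2 * m + 1"] m by simp
  have dim: "1 + (N + N) = 4 * m + 1" by (simp add: N_def)
  show e: "e \<in> carrier_vec (4 * m + 1)" and w: "w \<in> carrier_vec (4 * m + 1)"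
    unfolding e_def w_def dim[symmetric] by (intro append_carrier_vec vec_carrier)+
  have comb: "a \<cdot>\<^sub>v e + b \<cdot>\<^sub>v w
      = vec 1 (\<lambda>_. a) @\<^sub>v (vec N (\<lambda>i. a + b * (-1) ^ i) @\<^sub>v vec N (\<lambda>_. a))" for a b
    by (intro eq_vecI) (auto simp: e_def w_def)
  show "a = 0 \<and> b = 0" if "a \<cdot>\<^sub>v e + b \<cdot>\<^sub>v w = 0\<^sub>v (4 * m + 1)" for a b
  proof -
    \<comment> \<open>Coordinate 0 is \<open>a\<close>; coordinate 1 opens the \<open>u\<close>
      block, where the sign is positive, and is \<open>a + b\<close>.\<close>
    have "(a \<cdot>\<^sub>v e + b \<cdot>\<^sub>v w) $ 0 = 0" "(a \<cdot>\<^sub>v e + b \<cdot>\<^sub>v w) $ 1 = 0"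
      using that m by simp_all
    then show ?thesis using m by (simp add: comb N_def)
  qed
  show "mat_kernel ?L = {a \<cdot>\<^sub>v e + b \<cdot>\<^sub>v w | a b. True}"
  proof (intro equalityI subsetI)
    fix z assume z: "z \<in> mat_kernel ?L"
    define t u v where "t = z $ 0" and "u = vec N (\<lambda>i. z $ (1 + i))"
      and "v = vec N (\<lambda>i. z $ (1 + N + i))"
    have "z \<in> carrier_vec (1 + (N + N))"
      using mat_kernelD(1)[OF L z] by (simp only: dim)
    then have z_eq: "z = vec 1 (\<lambda>_. t) @\<^sub>v (u @\<^sub>v v)"
      by (intro eq_vecI) (auto simp: t_def u_def v_def)
    have "?L *\<^sub>v (vec 1 (\<lambda>_. t) @\<^sub>v (u @\<^sub>v v)) = 0\<^sub>v (4 * m + 1)"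
      using mat_kernelD(2)[OF L z] z_eq by simp
    then obtain b where "\<forall>i<2 * m. u $ i = t + b * (-1) ^ i \<and> v $ i = t"
      using L_mat_kernel_iff[OF m, of u v t] by (auto simp: u_def v_def N_def)
    then have "u = vec N (\<lambda>i. t + b * (-1) ^ i)" "v = vec N (\<lambda>_. t)"
      by (auto simp: N_def u_def v_def)
    then have "z = t \<cdot>\<^sub>v e + b \<cdot>\<^sub>v w"
      by (simp add: comb z_eq)
    then show "z \<in> {a \<cdot>\<^sub>v e + b \<cdot>\<^sub>v w | a b. True}" by blast
  next
    fix z assume "z \<in> {a \<cdot>\<^sub>v e + b \<cdot>\<^sub>v w | a b. True}"
    then obtain a b where z: "z = a \<cdot>\<^sub>v e + b \<cdot>\<^sub>v w" by blast
    show "z \<in> mat_kernel ?L"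
    proof (rule mat_kernelI[OF L])
      show "z \<in> carrier_vec (4 * m + 1)" using e w z by simp
      show "?L *\<^sub>v z = 0\<^sub>v (4 * m + 1)"
        unfolding z comb by (subst L_mat_kernel_iff[OF m]) (auto simp: N_def)
    qed
  qed
qed

theorem theorem4p23:
  fixes n :: nat
  assumes "n \<ge> 5" and "odd n"
  shows "vec_space.rank (2 * n - 1) (L_mat n) = 2 * n - 3"
proof -
  from assms obtain m where n: "n = 2 * m + 1" and m: "m \<ge> 2"
    by (auto elim!: oddE)
  have "L_mat n \<in> carrier_mat (2 * n - 1) (2 * n - 1)"
    using assms by (intro L_mat_carrier) auto
  \<comment> \<open>The order is \<open>4 * m + 1\<close>, so the rank is \<open>4 * m - 1\<close>,
    that is \<open>2 * n - 3\<close>.\<close>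
  from rank_plus_kernel_dim[OF this] L_mat_kernel_dim[OF m] show ?thesis
    by (simp add: n)
qed

end
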